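(* Let $\mathcal{Q}$ be a nonempty finite set of positive integers with largest element $q$, let $a=|\mathbb{N}_q-\mathcal{Q}|$, and let $p_1<p_2<\cdots<p_a$ be the elements of $\mathbb{N}_q-\mathcal{Q}$. If the elements of $\mathcal{Q}$ are a well-based sequence, then for all integers $n$ and $k$, $$B_n=\delta_{n,0}+B_{n-1}+B_{n-q-1}+\sum_{i=1}^a\left(B_{n-p_i}-B_{n-p_i-1}-\delta_{n,p_i}\right),$$ $$B_{n,k}=\delta_{n,0}\delta_{k,0}+B_{n-1,k}+B_{n-q-1,k-1}+\sum_{i=1}^a\left(B_{n-p_i,k-1}-B_{n-p_i-1,k-1}-\delta_{n,p_i}\delta_{k,1}\right).$$ If $\mathcal{Q}=\mathbb{N}_q$ (and so $a=0$) then the sums over $i$ are omitted.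
   Context: $\mathbb{N}_q=\{1,2,\ldots,q\}$; $\delta_{i,j}$ is $1$ if $i=j$ and $0$ otherwise. The elements of $\mathcal{Q}$ (with largest element $q$) are a well-based sequence if $a=|\mathbb{N}_q-\mathcal{Q}|$ is zero, or if for all $i,j\in\{1,\ldots,a\}$ (where $i$ and $j$ can be equal) $p_i+p_j\notin\mathcal{Q}$, where $p_1,\ldots,p_a$ are the elements of $\mathbb{N}_q-\mathcal{Q}$. An $N$-board is a linear array of $N$ unit square cells, numbered $1,\ldots,N$ from left to right. A square is a $1\times1$ tile. The comb corresponding to $\mathcal{Q}$ (where $q=\max\mathcal{Q}$) is a tile of length $q+1$ with cells numbered $0,1,\ldots,q$ from left to right, in which cell $0$ is filled and cell $i$ ($1\le i\le q$) is filled if and only if $i\in\mathcal{Q}$; unfilled cells are gaps and are not part of the tile. A restricted-overlap tiling of a board is a placement of tiles on the board (each tile lying entirely within the board) such that every cell of the board is covered by a filled cell of at least one tile, and the leftmost cell of each tile is not covered by any other tile; filled cells that are not the leftmost cells of their tiles are allowed to overlap one another. A tiling is determined by which tiles are placed at which positions. $B_n$ is the number of restricted-overlap tilings of an $n$-board using squares and combs corresponding to $\mathcal{Q}$, and $B_{n,k}$ is the number of such tilings that use exactly $k$ combs. By convention $B_0=B_{0,0}=1$, $B_n=0$ for $n<0$, and $B_{n,k}=0$ if $n<0$, $k<0$ or $n<k$. *)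

theory Defs
  imports Main
begin

definition gap_set :: "nat set \<Rightarrow> nat set" where
  "gap_set Q = {1..Max Q} - Q"

definition well_based :: "nat set \<Rightarrow> bool" where
  "well_based Q \<longleftrightarrow>
     card (gap_set Q) = 0 \<or> (\<forall>x\<in>gap_set Q. \<forall>y\<in>gap_set Q. x + y \<notin> Q)"

datatype tile = Square | Comb

fun tile_length :: "nat set \<Rightarrow> tile \<Rightarrow> nat" where
  "tile_length Q Square = 1"
| "tile_length Q Comb = Max Q + 1"

text \<open>Offsets, from the leftmost cell of the tile, of its filled cells.\<close>

fun filled_offsets :: "nat set \<Rightarrow> tile \<Rightarrow> nat set" where
  "filled_offsets Q Square = {0}"
| "filled_offsets Q Comb = insert 0 Q"

text \<open>
  A placed tile is a pair of a tile and the number of the board cell on which the leftmost cell of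
  the tile lies.
\<close>

definition covered_cells :: "nat set \<Rightarrow> tile \<times> nat \<Rightarrow> nat set" where
  "covered_cells Q p = (\<lambda>i. snd p + i) ` filled_offsets Q (fst p)"

text \<open>
  A set of placed tiles suffices, rather than a multiset: two copies of a tile at the same position
  would cover each other's leftmost cell.
\<close>

definition restricted_overlap_tiling :: "nat set \<Rightarrow> nat \<Rightarrow> (tile \<times> nat) set \<Rightarrow> bool" where
  "restricted_overlap_tiling Q N T \<longleftrightarrow>
     (\<forall>p\<in>T. 1 \<le> snd p \<and> snd p + tile_length Q (fst p) \<le> N + 1) \<and>
     (\<forall>x\<in>{1..N}. \<exists>p\<in>T. x \<in> covered_cells Q p) \<and>
     (\<forall>p\<in>T. \<forall>p'\<in>T. p' \<noteq> p \<longrightarrow> snd p \<notin> covered_cells Q p')"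

definition comb_count :: "(tile \<times> nat) set \<Rightarrow> nat" where
  "comb_count T = card {p \<in> T. fst p = Comb}"

text \<open>The numbers $B_n$ and $B_{n,k}$, extended by zero to negative indices.\<close>

definition num_tilings :: "nat set \<Rightarrow> int \<Rightarrow> int" where
  "num_tilings Q n =
     (if n < 0 then 0 else int (card {T. restricted_overlap_tiling Q (nat n) T}))"

definition num_tilings_combs :: "nat set \<Rightarrow> int \<Rightarrow> int \<Rightarrow> int" where
  "num_tilings_combs Q n k =
     (if n < 0 \<or> k < 0 \<or> n < k then 0
      else int (card {T. restricted_overlap_tiling Q (nat n) T \<and> comb_count T = nat k}))"

definition kronecker :: "int \<Rightarrow> int \<Rightarrow> int" where
  "kronecker i j = (if i = j then 1 else 0)"

text \<open>
  The sets counted above are finite, and the values at 0 and for $n < k$ are not mere conventions.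
\<close>

lemma tiling_subset:
  assumes "restricted_overlap_tiling Q N T"
  shows "T \<subseteq> {Square, Comb} \<times> {1..N}"
proof
  fix p assume p: "p \<in> T"
  obtain t c where tc: "p = (t, c)" by (cases p)
  have "1 \<le> c" "c + tile_length Q t \<le> N + 1"
    using assms p by (auto simp: restricted_overlap_tiling_def tc)
  then show "p \<in> {Square, Comb} \<times> {1..N}"
    by (cases t) (auto simp: tc)
qed

lemma finite_tilings: "finite {T. restricted_overlap_tiling Q N T}"
  by (rule finite_subset[of _ "Pow ({Square, Comb} \<times> {1..N})"])
     (use tiling_subset in auto)

lemma tilings_0: "{T. restricted_overlap_tiling Q 0 T} = {{}}"
proof -
  have "restricted_overlap_tiling Q 0 T \<longleftrightarrow> T = {}" for T
  proof
    assume "restricted_overlap_tiling Q 0 T"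
    from tiling_subset[OF this] show "T = {}" by simp
  next
    assume "T = {}"
    then show "restricted_overlap_tiling Q 0 T"
      by (simp add: restricted_overlap_tiling_def)
  qed
  then show ?thesis by simp
qed

lemma num_tilings_0: "num_tilings Q 0 = 1"
  by (simp add: num_tilings_def tilings_0)

lemma num_tilings_combs_0_0: "num_tilings_combs Q 0 0 = 1"
proof -
  have "{T. restricted_overlap_tiling Q 0 T \<and> comb_count T = 0} =
      {T. restricted_overlap_tiling Q 0 T} \<inter> {T. comb_count T = 0}"
    by (rule Collect_conj_eq)
  also have "\<dots> = {{}}"
    unfolding tilings_0 by (simp add: comb_count_def)
  finally have "{T. restricted_overlap_tiling Q 0 T \<and> comb_count T = 0} = {{}}" .
  then show ?thesis by (simp add: num_tilings_combs_def)
qed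

lemma comb_count_le:
  assumes "restricted_overlap_tiling Q N T"
  shows "comb_count T \<le> N"
proof -
  have "card {p \<in> T. fst p = Comb} \<le> card ({Comb} \<times> {1..N})"
    by (rule card_mono) (use tiling_subset[OF assms] in auto)
  then show ?thesis by (simp add: comb_count_def card_cartesian_product)
qed

end

theory Submission
  imports Defs
begin

text \<open>
  A tiling is determined by the set of positions of its combs, since the squares must sit exactly on
  the cells that no comb covers. The comb positions form an arbitrary subset of $\{1,\ldots,n-q\}$
  in which no two elements differ by an element of $\mathcal{Q}$. Such a set either avoids the
  last position $m$, or is $\{m\}\cup C$, where $C$ is empty or has maximum $m-g$ with $g>q$ or with
  $g$ a gap. In the last case well-basedness makes every such $C$ that is itself admissible
  compatible with $m$, because each other element of $C$ has a distance from $m$ that is a sum of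
  two gaps or exceeds $q$. The recurrences count these cases. Both recurrences are instances of a
  single one, in which the number of combs is restricted to a set $K$ of naturals.
\<close>

section \<open>Comb position sets and the tilings they determine\<close>

definition difference_free :: "nat set \<Rightarrow> nat set \<Rightarrow> bool" where
  "difference_free Q C \<longleftrightarrow> (\<forall>x\<in>C. \<forall>y\<in>C. \<forall>d\<in>Q. y \<noteq> x + d)"

text \<open>The bound \<open>m\<close> is the last cell on which a comb may start; a board of length
  \<open>N\<close> has \<open>m = N - Max Q\<close>.\<close>

definition comb_sets :: "nat set \<Rightarrow> nat set \<Rightarrow> nat \<Rightarrow> nat set set" where
  "comb_sets Q K m = {C. C \<subseteq> {1..m} \<and> difference_free Q C \<and> card C \<in> K}"

definition tiles_of :: "nat set \<Rightarrow> nat \<Rightarrow> nat set \<Rightarrow> (tile \<times> nat) set" where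
  "tiles_of Q N C = {Comb} \<times> C \<union>
     {Square} \<times> {x \<in> {1..N}. \<forall>c\<in>C. x \<noteq> c \<and> (\<forall>d\<in>Q. x \<noteq> c + d)}"

definition num_tilings_combs_in :: "nat set \<Rightarrow> nat set \<Rightarrow> int \<Rightarrow> int" where
  "num_tilings_combs_in Q K n = (if n < 0 then 0 else
     int (card {T. restricted_overlap_tiling Q (nat n) T \<and> comb_count T \<in> K}))"

lemma finite_comb_sets [simp]: "finite (comb_sets Q K m)"
  unfolding comb_sets_def by (rule finite_subset[of _ "Pow {1..m}"]) auto

lemma comb_sets_0: "comb_sets Q K 0 = (if 0 \<in> K then {{}} else {})"
  unfolding comb_sets_def difference_free_def by auto

lemma comb_sets_mono: "m \<le> m' \<Longrightarrow> comb_sets Q K m \<subseteq> comb_sets Q K m'"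
  unfolding comb_sets_def by auto

lemma comb_count_tiles_of: "comb_count (tiles_of Q N C) = card C"
proof -
  have "{t \<in> tiles_of Q N C. fst t = Comb} = Pair Comb ` C"
    by (auto simp: tiles_of_def)
  then show ?thesis
    by (simp add: comb_count_def card_image inj_on_def)
qed

lemma inj_tiles_of: "inj (tiles_of Q N)"
proof (rule injI)
  fix C D assume eq: "tiles_of Q N C = tiles_of Q N D"
  have "E = {c. (Comb, c) \<in> tiles_of Q N E}" for E
    by (auto simp: tiles_of_def)
  then show "C = D"
    using eq by metis
qed

lemma mem_covered_cells_iff:
  "x \<in> covered_cells Q (Square, c) \<longleftrightarrow> x = c"
  "x \<in> covered_cells Q (Comb, c) \<longleftrightarrow> x = c \<or> (\<exists>d\<in>Q. x = c + d)"
  by (auto simp: covered_cells_def)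

text \<open>Squares leave no choice: the only cell of a square is its leftmost one, so no comb may
  cover it, and a cell missed by all combs can be covered only by a square. If
  \<open>N \<le> Max Q\<close>, truncation makes the range of positions empty, as it should be,
  since no comb fits.\<close>

lemma tiling_iff_comb_set:
  assumes pos: "\<forall>x\<in>Q. 1 \<le> x" and fin: "finite Q"
  shows "restricted_overlap_tiling Q N T \<longleftrightarrow>
    (\<exists>C. C \<subseteq> {1..N - Max Q} \<and> difference_free Q C \<and> T = tiles_of Q N C)"
proof
  assume T: "restricted_overlap_tiling Q N T"
  define C where "C = {c. (Comb, c) \<in> T}"
  have len: "1 \<le> snd t" "snd t + tile_length Q (fst t) \<le> N + 1" if "t \<in> T" for t
    using T that by (auto simp: restricted_overlap_tiling_def)
  have cover: "\<exists>t\<in>T. x \<in> covered_cells Q t" if "x \<in> {1..N}" for x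
    using T that by (auto simp: restricted_overlap_tiling_def)
  have excl: "snd t \<notin> covered_cells Q t'" if "t \<in> T" "t' \<in> T" "t' \<noteq> t" for t t'
    using T that by (auto simp: restricted_overlap_tiling_def)
  have "C \<subseteq> {1..N - Max Q}"
    using len by (force simp: C_def)
  moreover have "difference_free Q C"
    unfolding difference_free_def
  proof (intro ballI notI)
    fix x y d assume *: "x \<in> C" "y \<in> C" "d \<in> Q" "y = x + d"
    \<comment> \<open>Exclusion applies only to distinct placed tiles; \<open>d\<close> being
      positive makes these two distinct.\<close>
    then have "(Comb, x) \<noteq> (Comb, y)" using pos by fastforce
    then show False
      using excl[of "(Comb, y)" "(Comb, x)"] * by (auto simp: C_def mem_covered_cells_iff)
  qed
  moreover have "(Square, x) \<in> T \<longleftrightarrow>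
      x \<in> {1..N} \<and> (\<forall>c\<in>C. x \<noteq> c \<and> (\<forall>d\<in>Q. x \<noteq> c + d))" for x
  proof
    assume x: "(Square, x) \<in> T"
    have "x \<notin> covered_cells Q (Comb, c)" if "c \<in> C" for c
      using excl[OF x, of "(Comb, c)"] that by (auto simp: C_def)
    moreover have "x \<in> {1..N}" using len[OF x] by auto
    ultimately show "x \<in> {1..N} \<and> (\<forall>c\<in>C. x \<noteq> c \<and> (\<forall>d\<in>Q. x \<noteq> c + d))"
      by (auto simp: mem_covered_cells_iff)
  next
    assume x: "x \<in> {1..N} \<and> (\<forall>c\<in>C. x \<noteq> c \<and> (\<forall>d\<in>Q. x \<noteq> c + d))"
    obtain t c where t: "(t, c) \<in> T" "x \<in> covered_cells Q (t, c)"
      using cover x by (metis surj_pair)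
    show "(Square, x) \<in> T"
      using t x by (cases t) (auto simp: C_def mem_covered_cells_iff)
  qed
  then have "(t, x) \<in> T \<longleftrightarrow> (t, x) \<in> tiles_of Q N C" for t x
    by (cases t) (auto simp: tiles_of_def C_def)
  then have "T = tiles_of Q N C" by auto
  ultimately show "\<exists>C. C \<subseteq> {1..N - Max Q} \<and> difference_free Q C \<and> T = tiles_of Q N C"
    by blast
next
  assume "\<exists>C. C \<subseteq> {1..N - Max Q} \<and> difference_free Q C \<and> T = tiles_of Q N C"
  then obtain C where C: "C \<subseteq> {1..N - Max Q}" and free: "difference_free Q C"
    and T: "T = tiles_of Q N C" by blast
  have "1 \<le> c \<and> c + Max Q \<le> N" if "c \<in> C" for c
    using that C by force
  then have "1 \<le> snd t \<and> snd t + tile_length Q (fst t) \<le> N + 1" if "t \<in> T" for t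
    using that by (auto simp: T tiles_of_def)
  moreover have "\<exists>t\<in>T. x \<in> covered_cells Q t" if "x \<in> {1..N}" for x
  proof (cases "\<exists>c\<in>C. x = c \<or> (\<exists>d\<in>Q. x = c + d)")
    case True
    then obtain c where "c \<in> C" "x \<in> covered_cells Q (Comb, c)"
      by (auto simp: mem_covered_cells_iff)
    then show ?thesis
      by (intro bexI[of _ "(Comb, c)"]) (auto simp: T tiles_of_def)
  next
    case False
    then show ?thesis
      using that by (intro bexI[of _ "(Square, x)"]) (auto simp: T tiles_of_def mem_covered_cells_iff)
  qed
  moreover have "snd t \<notin> covered_cells Q t'" if "t \<in> T" "t' \<in> T" "t' \<noteq> t" for t t'
    using that free
    by (auto simp: T tiles_of_def mem_covered_cells_iff difference_free_def)
  ultimately show "restricted_overlap_tiling Q N T"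
    by (simp add: restricted_overlap_tiling_def)
qed

lemma num_tilings_combs_in_eq_comb_sets:
  assumes "finite Q" "\<forall>x\<in>Q. 1 \<le> x"
  shows "num_tilings_combs_in Q K (int N) = int (card (comb_sets Q K (N - Max Q)))"
proof -
  have "{T. restricted_overlap_tiling Q N T \<and> comb_count T \<in> K}
      = tiles_of Q N ` comb_sets Q K (N - Max Q)"
    using tiling_iff_comb_set[OF assms(2,1)]
    by (auto simp: comb_sets_def comb_count_tiles_of)
  then show ?thesis
    by (simp add: num_tilings_combs_in_def card_image inj_on_subset[OF inj_tiles_of])
qed

section \<open>Splitting off the last comb\<close>

text \<open>Lets a difference of consecutive counts be read as the number of sets with maximum
  \<open>m\<close>. For \<open>m = 0\<close> both sides are false: the truncated
  \<open>m - 1\<close> is again 0, and cell 0 is never a position.\<close>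

lemma in_comb_sets_diff_iff:
  "C \<in> comb_sets Q K m - comb_sets Q K (m - 1) \<longleftrightarrow> C \<in> comb_sets Q K m \<and> m \<in> C"
proof (cases m)
  case (Suc j)
  then have "C \<subseteq> {1..m} \<Longrightarrow> C \<subseteq> {1..m - 1} \<longleftrightarrow> m \<notin> C"
    by (force simp: le_Suc_eq)
  then show ?thesis by (auto simp: comb_sets_def)
qed (auto simp: comb_sets_def)

text \<open>The new position lies beyond all of \<open>D\<close>, so the only new conditions concern
  distances up to it. The set for \<open>D\<close> is shifted because one comb has been
  removed.\<close>

lemma insert_mem_comb_sets_iff:
  assumes "\<forall>x\<in>Q. 1 \<le> x" "Suc m \<notin> D"
  shows "insert (Suc m) D \<in> comb_sets Q K (Suc m) \<longleftrightarrow>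
    D \<in> comb_sets Q {j. Suc j \<in> K} m \<and> (\<forall>x\<in>D. Suc m - x \<notin> Q)"
proof (cases "D \<subseteq> {1..m}")
  case True
  then have "finite D" by (rule finite_subset) simp
  moreover have "difference_free Q (insert (Suc m) D) \<longleftrightarrow>
      difference_free Q D \<and> (\<forall>x\<in>D. Suc m - x \<notin> Q)"
  proof -
    \<comment> \<open>Ordered pairs are sorted by which members equal \<open>Suc m\<close>; the
      first two groups of conditions hold automatically.\<close>
    have "difference_free Q (insert (Suc m) D) \<longleftrightarrow>
        (\<forall>d\<in>Q. Suc m \<noteq> Suc m + d) \<and> (\<forall>x\<in>D. \<forall>d\<in>Q. x \<noteq> Suc m + d) \<and>
        (\<forall>x\<in>D. \<forall>d\<in>Q. Suc m \<noteq> x + d) \<and> difference_free Q D"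
      by (simp only: difference_free_def ball_simps(7) ball_conj_distrib conj_ac)
    moreover have "\<forall>d\<in>Q. Suc m \<noteq> Suc m + d"
      using assms(1) by auto
    moreover have "\<forall>x\<in>D. \<forall>d\<in>Q. x \<noteq> Suc m + d"
      using True by auto
    moreover have "(\<forall>d\<in>Q. Suc m \<noteq> x + d) \<longleftrightarrow> Suc m - x \<notin> Q" if "x \<in> D" for x
    proof -
      have "Suc m = x + d \<longleftrightarrow> d = Suc m - x" for d
        using True that by auto
      then show ?thesis by metis
    qed
    ultimately show ?thesis by (simp add: conj_commute)
  qed
  moreover have "insert (Suc m) D \<subseteq> {1..Suc m}" using True by auto
  ultimately show ?thesis
    using True assms(2) by (simp add: comb_sets_def conj_ac)
next
  case False
  then have "\<not> insert (Suc m) D \<subseteq> {1..Suc m}"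
    using assms(2) by (force simp: le_Suc_eq)
  then show ?thesis
    using False by (simp add: comb_sets_def)
qed

section \<open>Well-basedness and compatibility with a new last comb\<close>

lemma gap_set_iff: "g \<in> gap_set Q \<longleftrightarrow> 1 \<le> g \<and> g \<le> Max Q \<and> g \<notin> Q"
  by (auto simp: gap_set_def)

text \<open>Well-basedness speaks only of two gaps. Here \<open>y\<close> may also be 0, when the
  sum is the gap \<open>x\<close>, or exceed \<open>Max Q\<close>, when the sum does too.\<close>

lemma well_based_sum_notin:
  assumes "well_based Q" "finite Q" "x \<in> gap_set Q" "y \<notin> Q"
  shows "x + y \<notin> Q"
proof
  assume xy: "x + y \<in> Q"
  then have "x + y \<le> Max Q" using assms(2) by simp
  then have y: "y \<in> gap_set Q"
    using assms(3,4) xy by (cases "y = 0") (auto simp: gap_set_iff)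
  have "finite (gap_set Q)" by (simp add: gap_set_def)
  then have "card (gap_set Q) \<noteq> 0" using y by auto
  then show False
    using assms(1,3) y xy by (auto simp: well_based_def)
qed

text \<open>The truncated differences \<open>Suc m - g\<close> are harmless: cell 0 is in no comb set.\<close>

lemma compatible_comb_sets:
  assumes Q: "finite Q" "\<forall>x\<in>Q. 1 \<le> x" and wb: "well_based Q"
  shows "{D \<in> comb_sets Q K m. \<forall>x\<in>D. Suc m - x \<notin> Q} =
    comb_sets Q K (m - Max Q) \<union>
    (\<Union>g\<in>gap_set Q. comb_sets Q K (Suc m - g) - comb_sets Q K (Suc m - g - 1))"
    (is "?L = ?A \<union> ?B")
proof (intro equalityI subsetI)
  fix D assume "D \<in> ?L"
  then have D: "D \<subseteq> {1..m}" "difference_free Q D" "card D \<in> K"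
    and far: "\<And>x. x \<in> D \<Longrightarrow> Suc m - x \<notin> Q"
    by (auto simp: comb_sets_def)
  have fin: "finite D" using D(1) by (rule finite_subset) simp
  show "D \<in> ?A \<union> ?B"
  proof (cases "D \<subseteq> {1..m - Max Q}")
    case True
    then show ?thesis using D by (simp add: comb_sets_def)
  next
    case False
    \<comment> \<open>Since \<open>y\<close> is within \<open>Max Q\<close> of \<open>Suc m\<close>,
      so is the maximum \<open>M\<close> of \<open>D\<close>; hence \<open>Suc m - M\<close> is the
      required gap.\<close>
    then obtain y where y: "y \<in> D" "y > m - Max Q" using D(1) by force
    define M where "M = Max D"
    have M: "M \<in> D" "D \<subseteq> {1..M}"
      using fin y(1) D(1) by (auto simp: M_def intro: Max_in)
    have My: "y \<le> M" "M \<le> m" "1 \<le> M" using M D(1) y(1) by auto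
    then have "Suc m - M \<in> gap_set Q"
      using y(2) far[OF M(1)] by (auto simp: gap_set_iff)
    moreover have "Suc m - (Suc m - M) = M" using My by simp
    moreover have "D \<in> comb_sets Q K M - comb_sets Q K (M - 1)"
      unfolding in_comb_sets_diff_iff using M D by (simp add: comb_sets_def)
    ultimately show ?thesis by (metis UN_I UnI2)
  qed
next
  fix D assume "D \<in> ?A \<union> ?B"
  then consider "D \<in> ?A"
    | g where "g \<in> gap_set Q" "D \<in> comb_sets Q K (Suc m - g)" "Suc m - g \<in> D"
    unfolding Un_iff UN_iff in_comb_sets_diff_iff by blast
  then show "D \<in> ?L"
  proof cases
    case 1
    have "Suc m - x \<notin> Q" if "x \<in> D" for x
    proof -
      have "Suc m - x > Max Q" using that 1 by (force simp: comb_sets_def)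
      then show ?thesis using Q(1) Max_ge not_le by blast
    qed
    then show ?thesis
      using 1 comb_sets_mono[of "m - Max Q" m] by auto
  next
    case 2
    have g: "1 \<le> g" using 2(1) by (simp add: gap_set_iff)
    have D: "D \<subseteq> {1..Suc m - g}" "difference_free Q D"
      using 2 by (auto simp: comb_sets_def)
    \<comment> \<open>Membership of \<open>Suc m - g\<close> in \<open>D\<close> makes it positive,
      so this subtraction is not truncated.\<close>
    have gm: "g \<le> m" using D(1) 2(3) by auto
    have "Suc m - x \<notin> Q" if "x \<in> D" for x
    proof -
      have x: "x \<le> Suc m - g" using that D(1) by auto
      \<comment> \<open>The distance from \<open>x\<close> to \<open>Suc m\<close> is the gap
        \<open>g\<close> plus the distance from \<open>x\<close> to the maximum
        \<open>Suc m - g\<close> of \<open>D\<close>, and the latter is not in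
        \<open>Q\<close>.\<close>
      have "(Suc m - g) - x \<notin> Q"
        using D(2) that 2(3) x unfolding difference_free_def
        by (metis le_add_diff_inverse)
      then have "g + ((Suc m - g) - x) \<notin> Q"
        using well_based_sum_notin[OF wb Q(1) 2(1)] by blast
      then show ?thesis using x gm by simp
    qed
    moreover have "D \<in> comb_sets Q K m"
      using 2(2) comb_sets_mono[of "Suc m - g" m Q K] g by force
    ultimately show ?thesis by simp
  qed
qed

lemma card_comb_sets_Suc:
  assumes Q: "finite Q" "\<forall>x\<in>Q. 1 \<le> x" and wb: "well_based Q"
  defines "K' \<equiv> \<lambda>K. {j. Suc j \<in> K}"
  shows "int (card (comb_sets Q K (Suc m))) =
    int (card (comb_sets Q K m)) + int (card (comb_sets Q (K' K) (m - Max Q))) +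
    (\<Sum>g\<in>gap_set Q. int (card (comb_sets Q (K' K) (Suc m - g)))
       - int (card (comb_sets Q (K' K) (Suc m - g - 1))))"
proof -
  define E where "E g = comb_sets Q (K' K) (Suc m - g) - comb_sets Q (K' K) (Suc m - g - 1)" for g
  define L where "L = {D \<in> comb_sets Q (K' K) m. \<forall>x\<in>D. Suc m - x \<notin> Q}"
  have fin [simp]: "finite (gap_set Q)" "\<And>g. finite (E g)"
    by (simp_all add: gap_set_def E_def)
  have finL: "finite L" by (simp add: L_def)
  have notin: "Suc m \<notin> D" if "D \<in> comb_sets Q J m" for D J
    using that by (auto simp: comb_sets_def)
  have split: "comb_sets Q K (Suc m) = comb_sets Q K m \<union> insert (Suc m) ` L"
  proof (intro equalityI subsetI)
    fix C assume C: "C \<in> comb_sets Q K (Suc m)"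
    show "C \<in> comb_sets Q K m \<union> insert (Suc m) ` L"
    proof (cases "Suc m \<in> C")
      case True
      then have "insert (Suc m) (C - {Suc m}) = C" by auto
      moreover from this have "C - {Suc m} \<in> L"
        using C insert_mem_comb_sets_iff[OF Q(2), of m "C - {Suc m}" K]
        by (simp add: L_def K'_def)
      ultimately show ?thesis by (metis UnI2 imageI)
    next
      case False
      then show ?thesis
        using C in_comb_sets_diff_iff[of C Q K "Suc m"] by auto
    qed
  next
    fix C assume "C \<in> comb_sets Q K m \<union> insert (Suc m) ` L"
    then show "C \<in> comb_sets Q K (Suc m)"
      using comb_sets_mono[of m "Suc m" Q K] notin insert_mem_comb_sets_iff[OF Q(2), of m _ K]
      by (auto simp: L_def K'_def)
  qed
  have disj: "comb_sets Q K m \<inter> insert (Suc m) ` L = {}"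
    using notin by auto
  have "inj_on (insert (Suc m)) L"
    by (rule inj_onI) (use notin in \<open>auto simp: L_def insert_ident\<close>)
  then have 1: "card (comb_sets Q K (Suc m)) = card (comb_sets Q K m) + card L"
    unfolding split by (simp add: card_Un_disjoint disj finL card_image)
  have L: "L = comb_sets Q (K' K) (m - Max Q) \<union> (\<Union>g\<in>gap_set Q. E g)"
    unfolding L_def E_def by (rule compatible_comb_sets[OF Q wb])
  have E: "Suc m - g \<in> D \<and> D \<subseteq> {1..Suc m - g}" if "D \<in> E g" for D g
    using that unfolding E_def in_comb_sets_diff_iff by (auto simp: comb_sets_def)
  have 2: "card L = card (comb_sets Q (K' K) (m - Max Q)) + card (\<Union>g\<in>gap_set Q. E g)"
    unfolding L
  proof (rule card_Un_disjoint)
    \<comment> \<open>As \<open>g \<le> Max Q\<close>, the element \<open>Suc m - g\<close> of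
      \<open>D\<close> lies beyond \<open>m - Max Q\<close>.\<close>
    have False if "D \<in> comb_sets Q (K' K) (m - Max Q)" "g \<in> gap_set Q" "D \<in> E g" for D g
      using that(1,2) E[OF that(3)] by (force simp: comb_sets_def gap_set_iff)
    then show "comb_sets Q (K' K) (m - Max Q) \<inter> (\<Union>g\<in>gap_set Q. E g) = {}" by blast
  qed auto
  have 3: "card (\<Union>g\<in>gap_set Q. E g) = (\<Sum>g\<in>gap_set Q. card (E g))"
  proof (rule card_UN_disjoint)
    \<comment> \<open>Both \<open>Suc m - g\<close> and \<open>Suc m - h\<close> are the maximum of
      \<open>D\<close>, and both are positive, so \<open>g\<close> and \<open>h\<close> can be
      recovered from them.\<close>
    have "g = h" if "D \<in> E g" "D \<in> E h" for D g h
      using E[OF that(1)] E[OF that(2)] by force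
    then show "\<forall>g\<in>gap_set Q. \<forall>h\<in>gap_set Q. g \<noteq> h \<longrightarrow> E g \<inter> E h = {}" by blast
  qed auto
  have 4: "int (card (E g)) = int (card (comb_sets Q (K' K) (Suc m - g)))
      - int (card (comb_sets Q (K' K) (Suc m - g - 1)))" for g
    unfolding E_def using comb_sets_mono[of "Suc m - g - 1" "Suc m - g" Q "K' K"]
    by (simp add: card_Diff_subset card_mono of_nat_diff)
  show ?thesis
    unfolding 1 2 3 using 4 by simp
qed

section \<open>The recurrence for a restricted number of combs\<close>

lemma num_tilings_combs_in_rec:
  assumes Q: "finite Q" "\<forall>x\<in>Q. 1 \<le> x" and wb: "well_based Q"
  defines "K' \<equiv> \<lambda>K. {j. Suc j \<in> K}"
  shows "num_tilings_combs_in Q K n =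
    kronecker n 0 * of_bool (0 \<in> K) + num_tilings_combs_in Q K (n - 1)
    + num_tilings_combs_in Q (K' K) (n - int (Max Q) - 1)
    + (\<Sum>g\<in>gap_set Q. num_tilings_combs_in Q (K' K) (n - int g)
         - num_tilings_combs_in Q (K' K) (n - int g - 1) - kronecker n (int g) * of_bool (0 \<in> K' K))"
proof (cases "n \<le> int (Max Q)")
  case True
  \<comment> \<open>No comb fits on such a board, so the all-square tiling is the only one.\<close>
  have small: "num_tilings_combs_in Q J i = of_bool (0 \<le> i \<and> 0 \<in> J)" if "i \<le> int (Max Q)" for J i
  proof (cases "i < 0")
    case False
    then obtain N where "i = int N" by (metis nonneg_int_cases not_less)
    then show ?thesis
      using that by (simp add: num_tilings_combs_in_eq_comb_sets[OF Q] comb_sets_0)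
  qed (simp add: num_tilings_combs_in_def)
  \<comment> \<open>The difference of counts is nonzero only across the jump from index -1 to index
    0, that is at \<open>n = int g\<close>, and there the Kronecker term cancels it.\<close>
  have "num_tilings_combs_in Q (K' K) (n - int g) - num_tilings_combs_in Q (K' K) (n - int g - 1)
      - kronecker n (int g) * of_bool (0 \<in> K' K) = 0" if "g \<in> gap_set Q" for g
    using True by (simp add: small kronecker_def)
  then show ?thesis
    using True by (auto simp: small kronecker_def)
next
  case False
  \<comment> \<open>Chosen so that \<open>Suc m\<close> is the last possible comb position on a
    board of length \<open>n\<close>.\<close>
  define m where "m = nat (n - int (Max Q) - 1)"
  have n: "n = int (Suc m + Max Q)" using False by (simp add: m_def)
  have w: "num_tilings_combs_in Q J (int N) = int (card (comb_sets Q J (N - Max Q)))" for J N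
    by (rule num_tilings_combs_in_eq_comb_sets[OF Q])
  have "n - 1 = int (m + Max Q)" "n - int (Max Q) - 1 = int m" by (simp_all add: n)
  then have terms: "num_tilings_combs_in Q K n = int (card (comb_sets Q K (Suc m)))"
    "num_tilings_combs_in Q K (n - 1) = int (card (comb_sets Q K m))"
    "num_tilings_combs_in Q (K' K) (n - int (Max Q) - 1) = int (card (comb_sets Q (K' K) (m - Max Q)))"
    unfolding n by (simp_all only: w) (simp_all)
  have "num_tilings_combs_in Q (K' K) (n - int g) - num_tilings_combs_in Q (K' K) (n - int g - 1)
      - kronecker n (int g) * of_bool (0 \<in> K' K) =
      int (card (comb_sets Q (K' K) (Suc m - g))) - int (card (comb_sets Q (K' K) (Suc m - g - 1)))"
    if "g \<in> gap_set Q" for g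
  proof -
    have g: "g \<le> Max Q" using that by (simp add: gap_set_iff)
    then have "n - int g = int (Suc m + Max Q - g)" "n - int g - 1 = int (m + Max Q - g)"
      by (simp_all add: n)
    moreover have "Suc m + Max Q - g - Max Q = Suc m - g" "m + Max Q - g - Max Q = Suc m - g - 1"
      using g by simp_all
    moreover have "kronecker n (int g) = 0" using g by (simp add: kronecker_def n)
    ultimately show ?thesis by (simp only: w mult_zero_left diff_zero)
  qed
  moreover have "kronecker n 0 = 0" by (simp add: kronecker_def n)
  ultimately show ?thesis
    unfolding terms using card_comb_sets_Suc[OF Q wb, of K m] by (simp add: K'_def)
qed

section \<open>Specialisation to the two recurrences\<close>

lemma num_tilings_eq_combs_in: "num_tilings Q n = num_tilings_combs_in Q UNIV n"
  by (simp add: num_tilings_def num_tilings_combs_in_def)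

lemma num_tilings_combs_eq_combs_in:
  "num_tilings_combs Q n k = num_tilings_combs_in Q {j. int j = k} n"
proof (cases "n < 0 \<or> k < 0 \<or> n < k")
  case True
  \<comment> \<open>For \<open>n \<ge> 0\<close> the values that are zero by convention are true
    counts: no tiling has a negative number of combs or more combs than cells.\<close>
  have "{T. restricted_overlap_tiling Q (nat n) T \<and> int (comb_count T) = k} = {}" if "0 \<le> n"
    using True that comb_count_le[of Q "nat n"] by fastforce
  then show ?thesis
    using True by (cases "n < 0") (simp_all only: num_tilings_combs_def num_tilings_combs_in_def
        mem_Collect_eq not_less simp_thms if_True card.empty of_nat_0 if_cancel)
next
  case False
  then have "int j = k \<longleftrightarrow> j = nat k" for j by auto
  then show ?thesis
    using False by (simp add: num_tilings_combs_def num_tilings_combs_in_def)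
qed

theorem theorem5:
  fixes Q :: "nat set" and q a :: nat and p :: "nat \<Rightarrow> nat" and n k :: int
  assumes "finite Q" and "Q \<noteq> {}" and "\<forall>x\<in>Q. 1 \<le> x"
    and "q = Max Q"
    and "a = card ({1..q} - Q)"
    and "strict_mono_on {1..a} p" and "p ` {1..a} = {1..q} - Q"
    and "well_based Q"
  shows
    "num_tilings Q n =
       kronecker n 0 + num_tilings Q (n - 1) + num_tilings Q (n - int q - 1)
       + (\<Sum>i=1..a. num_tilings Q (n - int (p i)) - num_tilings Q (n - int (p i) - 1)
                     - kronecker n (int (p i)))
     \<and>
     num_tilings_combs Q n k =
       kronecker n 0 * kronecker k 0 + num_tilings_combs Q (n - 1) k
       + num_tilings_combs Q (n - int q - 1) (k - 1)
       + (\<Sum>i=1..a. num_tilings_combs Q (n - int (p i)) (k - 1)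
                     - num_tilings_combs Q (n - int (p i) - 1) (k - 1)
                     - kronecker n (int (p i)) * kronecker k 1)"
proof -
  have gaps: "p ` {1..a} = gap_set Q"
    using assms(4,7) by (simp add: gap_set_def)
  have reindex: "(\<Sum>g\<in>gap_set Q. f g) = (\<Sum>i=1..a. f (p i))" for f :: "nat \<Rightarrow> int"
    using sum.reindex[OF strict_mono_on_imp_inj_on[OF assms(6)], of f]
    by (simp only: gaps o_def)
  \<comment> \<open>One comb fewer means \<open>k - 1\<close>; for \<open>k \<le> 0\<close> both
    sets are empty, in agreement with the zero convention.\<close>
  have shift: "{j. Suc j \<in> {j. int j = k}} = {j. int j = k - 1}" by auto
  have zero: "of_bool (0 \<in> {j. int j = k}) = kronecker k 0"
    "of_bool (0 \<in> {j. int j = k - 1}) = kronecker k 1"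
    by (auto simp: kronecker_def)
  note rec = num_tilings_combs_in_rec[OF assms(1,3,8)]
  show ?thesis
    using rec[of UNIV n] rec[of "{j. int j = k}" n]
    unfolding num_tilings_eq_combs_in num_tilings_combs_eq_combs_in reindex shift zero assms(4)
    by simp
qed

end
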